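(* Let $\mu$ be a probability measure on $\mathbb{R}^d$. The function $W\mapsto C(\mu,W)^{-1}$ is concave over the convex cone of symmetric positive-semidefinite matrix fields $W:\mathbb{R}^d\to\mathcal{S}_+^d$. Furthermore, for any symmetric positive-semidefinite matrix fields $W$ and $W'$ such that $W'\preceq\Omega W$ for some constant $\Omega$, we have $$\frac{1}{C(\mu,W')}\le\frac{1}{C(\mu,W)}+\int\mathrm{tr}\big((W'-W)G\big)\,\mathrm{d}\mu$$ for any $G\in\mathcal{G}(W)$, where $$\mathcal{G}(W)=\mathrm{conv}\left\{\frac{\nabla u\,\nabla u^\top}{\int u^2\,\mathrm{d}\mu}\;:\;u\in\underset{\substack{f\in H^1(\mu,W)\\ \int f\,\mathrm{d}\mu=0}}{\mathrm{arg\,min}}\ \frac{\int\nabla f^\top W\nabla f\,\mathrm{d}\mu}{\int f^2\,\mathrm{d}\mu}\right\}$$ and $\mathrm{conv}\{\cdot\}$ denotes the convex hull of a set.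
   Context: $\mathcal{S}_+^d\subset\mathbb{R}^{d\times d}$ is the convex cone of symmetric positive-semidefinite matrices and $\preceq$ is the Loewner order (understood pointwise for matrix fields). The weighted Sobolev space is $$H^1(\mu,W)=\Big\{f:\mathbb{R}^d\to\mathbb{R}:\ \|f\|_{H^1(\mu,W)}^2=\int f^2\,\mathrm{d}\mu+\int\nabla f^\top W\nabla f\,\mathrm{d}\mu<\infty\Big\},$$ with $\nabla f$ the weak gradient. The Poincaré constant $C(\mu,W)$ is the smallest constant in the inequality $\mathrm{Var}_\mu(f)\le C(\mu,W)\int\nabla f^\top W\nabla f\,\mathrm{d}\mu$, $f\in H^1(\mu,W)$, so that $$\frac{1}{C(\mu,W)}=\inf_{\substack{f\in H^1(\mu,W)\\ \int f\,\mathrm{d}\mu=0}}\frac{\int\nabla f^\top W\nabla f\,\mathrm{d}\mu}{\int f^2\,\mathrm{d}\mu}$$ (over $f$ with $\int f^2\,\mathrm{d}\mu\neq 0$; the value is $0$ when $C(\mu,W)=\infty$). *)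

theory Defs
  imports "HOL-Probability.Probability" "HOL-Library.Function_Algebras"
begin

text \<open>
  Matrix fields form a real vector space under the pointwise operations, so that the library's
  \<^const>\<open>convex\<close> and \<open>convex hull\<close> apply to sets of them.
\<close>

instantiation "fun" :: (type, real_vector) real_vector
begin

definition scaleR_fun :: "real \<Rightarrow> ('a \<Rightarrow> 'b) \<Rightarrow> 'a \<Rightarrow> 'b" where
  "scaleR_fun c f = (\<lambda>x. c *\<^sub>R f x)"

instance
  by standard (simp_all add: scaleR_fun_def plus_fun_def fun_eq_iff scaleR_add_right scaleR_add_left)

end

lemma scaleR_fun_apply [simp]: "(c *\<^sub>R f) x = c *\<^sub>R f x"
  by (simp add: scaleR_fun_def)


subsection \<open>Weak gradients\<close>

definition partial_deriv :: "'n::finite \<Rightarrow> (real^'n \<Rightarrow> real) \<Rightarrow> real^'n \<Rightarrow> real" where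
  "partial_deriv i \<phi> = (\<lambda>x. frechet_derivative \<phi> (at x) (axis i 1))"

primrec C_k :: "nat \<Rightarrow> (real^'n::finite \<Rightarrow> real) \<Rightarrow> bool" where
  "C_k 0 \<phi> \<longleftrightarrow> continuous_on UNIV \<phi>"
| "C_k (Suc k) \<phi> \<longleftrightarrow> (\<forall>x. \<phi> differentiable (at x)) \<and> (\<forall>i. C_k k (partial_deriv i \<phi>))"

definition test_function :: "(real^'n::finite \<Rightarrow> real) \<Rightarrow> bool" where
  "test_function \<phi> \<longleftrightarrow> (\<forall>k. C_k k \<phi>) \<and> compact (closure {x. \<phi> x \<noteq> 0})"

definition locally_integrable ::
    "(real^'n::finite \<Rightarrow> 'b::{banach, second_countable_topology}) \<Rightarrow> bool" where
  "locally_integrable f \<longleftrightarrow> (\<forall>K. compact K \<longrightarrow> set_integrable lborel K f)"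

definition has_weak_gradient :: "(real^'n::finite \<Rightarrow> real) \<Rightarrow> (real^'n \<Rightarrow> real^'n) \<Rightarrow> bool" where
  "has_weak_gradient f g \<longleftrightarrow>
     f \<in> borel_measurable borel \<and> locally_integrable f \<and>
     g \<in> borel_measurable borel \<and> locally_integrable g \<and>
     (\<forall>\<phi> i. test_function \<phi> \<longrightarrow>
        (LINT x|lborel. f x * partial_deriv i \<phi> x) = - (LINT x|lborel. g x $ i * \<phi> x))"

text \<open>
  A weak gradient is determined only up to Lebesgue-null sets; a Borel version is selected.
  When \<open>\<mu>\<close> is absolutely continuous with respect to Lebesgue measure, nothing below depends on the
  selected version, since \<open>weak_grad f\<close> only enters through integrals with respect to \<open>\<mu>\<close>.
  The selection depends on \<open>f\<close> only through the set of its weak gradients, hence is unchanged when a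
  constant is added to \<open>f\<close>.
\<close>

definition weak_grad :: "(real^'n::finite \<Rightarrow> real) \<Rightarrow> real^'n \<Rightarrow> real^'n" where
  "weak_grad f = (SOME g. has_weak_gradient f g)"


subsection \<open>Positive-semidefinite matrix fields\<close>

definition psd_matrices :: "(real^'n::finite^'n) set" where
  "psd_matrices = {A. transpose A = A \<and> (\<forall>v. 0 \<le> v \<bullet> (A *v v))}"

definition loewner_le :: "real^'n::finite^'n \<Rightarrow> real^'n^'n \<Rightarrow> bool" (infix "\<preceq>\<^sub>L" 50) where
  "A \<preceq>\<^sub>L B \<longleftrightarrow> B - A \<in> psd_matrices"

definition psd_fields :: "(real^'n::finite \<Rightarrow> real^'n^'n) set" where
  "psd_fields = {W. W \<in> borel_measurable borel \<and> (\<forall>x. W x \<in> psd_matrices)}"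

lemma convex_cone_psd_fields: "convex_cone (psd_fields :: (real^'n::finite \<Rightarrow> real^'n^'n) set)"
  unfolding convex_cone_iff
proof (intro conjI ballI allI impI)
  show "(0 :: real^'n \<Rightarrow> real^'n^'n) \<in> psd_fields"
    by (simp add: psd_fields_def psd_matrices_def zero_fun_def transpose_def vec_eq_iff)
next
  fix V W :: "real^'n \<Rightarrow> real^'n^'n" assume "V \<in> psd_fields" "W \<in> psd_fields"
  then show "V + W \<in> psd_fields"
    by (auto simp: psd_fields_def psd_matrices_def plus_fun_def transpose_def vec_eq_iff
        matrix_vector_mult_add_rdistrib inner_add_right)
next
  fix W :: "real^'n \<Rightarrow> real^'n^'n" and c :: real assume "W \<in> psd_fields" "0 \<le> c"
  then show "c *\<^sub>R W \<in> psd_fields"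
    by (auto simp: psd_fields_def psd_matrices_def scaleR_fun_def transpose_def vec_eq_iff
        scaleR_matrix_vector_assoc[symmetric])
qed


subsection \<open>Weighted Sobolev space and Poincare constant\<close>

definition l2_sq :: "(real^'n::finite) measure \<Rightarrow> (real^'n \<Rightarrow> real) \<Rightarrow> ennreal" where
  "l2_sq \<mu> f = (\<integral>\<^sup>+ x. ennreal ((f x)\<^sup>2) \<partial>\<mu>)"

text \<open>For \<open>W \<in> psd_fields\<close> the integrand is nonnegative, so \<^const>\<open>ennreal\<close> truncates nothing.\<close>

definition energy ::
    "(real^'n::finite) measure \<Rightarrow> (real^'n \<Rightarrow> real^'n^'n) \<Rightarrow> (real^'n \<Rightarrow> real) \<Rightarrow> ennreal" where
  "energy \<mu> W f = (\<integral>\<^sup>+ x. ennreal (weak_grad f x \<bullet> (W x *v weak_grad f x)) \<partial>\<mu>)"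

definition H1 ::
    "(real^'n::finite) measure \<Rightarrow> (real^'n \<Rightarrow> real^'n^'n) \<Rightarrow> (real^'n \<Rightarrow> real) set" where
  "H1 \<mu> W = {f. (\<exists>g. has_weak_gradient f g) \<and> l2_sq \<mu> f + energy \<mu> W f < \<infinity>}"

definition var :: "(real^'n::finite) measure \<Rightarrow> (real^'n \<Rightarrow> real) \<Rightarrow> ennreal" where
  "var \<mu> f = l2_sq \<mu> (\<lambda>x. f x - (LINT y|\<mu>. f y))"

text \<open>
  The infimum is attained unless the set is empty, in which case it is \<open>\<infinity>\<close>. The value \<open>\<infinity>\<close> belongs
  to the set only if every \<open>f\<close> with zero energy has zero variance, because \<open>\<infinity> * 0 = 0\<close>.
\<close>

definition poincare_const ::
    "(real^'n::finite) measure \<Rightarrow> (real^'n \<Rightarrow> real^'n^'n) \<Rightarrow> ennreal" where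
  "poincare_const \<mu> W = Inf {C. \<forall>f\<in>H1 \<mu> W. var \<mu> f \<le> C * energy \<mu> W f}"

definition concave_on_ennreal :: "'a::real_vector set \<Rightarrow> ('a \<Rightarrow> ennreal) \<Rightarrow> bool" where
  "concave_on_ennreal S F \<longleftrightarrow> convex S \<and>
     (\<forall>x\<in>S. \<forall>y\<in>S. \<forall>u\<ge>0. \<forall>v\<ge>0. u + v = 1 \<longrightarrow>
        ennreal u * F x + ennreal v * F y \<le> F (u *\<^sub>R x + v *\<^sub>R y))"


subsection \<open>Minimizers of the Rayleigh quotient\<close>

definition rayleigh ::
    "(real^'n::finite) measure \<Rightarrow> (real^'n \<Rightarrow> real^'n^'n) \<Rightarrow> (real^'n \<Rightarrow> real) \<Rightarrow> ennreal" where
  "rayleigh \<mu> W f = energy \<mu> W f / l2_sq \<mu> f"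

definition minimizers ::
    "(real^'n::finite) measure \<Rightarrow> (real^'n \<Rightarrow> real^'n^'n) \<Rightarrow> (real^'n \<Rightarrow> real) set" where
  "minimizers \<mu> W = {u. is_arg_min (rayleigh \<mu> W)
     (\<lambda>f. f \<in> H1 \<mu> W \<and> (LINT x|\<mu>. f x) = 0 \<and> l2_sq \<mu> f \<noteq> 0) u}"

definition normalized_outer ::
    "(real^'n::finite) measure \<Rightarrow> (real^'n \<Rightarrow> real) \<Rightarrow> real^'n \<Rightarrow> real^'n^'n" where
  "normalized_outer \<mu> u = (\<lambda>x. (1 / (LINT y|\<mu>. (u y)\<^sup>2)) *\<^sub>R
     (\<chi> i j. weak_grad u x $ i * weak_grad u x $ j))"

definition supergradients ::
    "(real^'n::finite) measure \<Rightarrow> (real^'n \<Rightarrow> real^'n^'n) \<Rightarrow> (real^'n \<Rightarrow> real^'n^'n) set" where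
  "supergradients \<mu> W = convex hull (normalized_outer \<mu> ` minimizers \<mu> W)"

end

theory Submission
  imports Defs
begin

text \<open>
  The number \<open>1 / C(\<mu>,W)\<close> is the largest \<open>c\<close> with \<open>c \<cdot> Var f \<le> energy W f\<close> on \<open>H\<^sup>1(\<mu>,W)\<close>, so it is an
  infimum of functions that are linear in \<open>W\<close>, hence concave. For a minimizer \<open>u\<close> at \<open>W\<close>, domination
  puts \<open>u\<close> in \<open>H\<^sup>1(\<mu>,W')\<close>; the Rayleigh quotient of \<open>u\<close> at \<open>W'\<close> bounds \<open>1 / C(\<mu>,W')\<close> from above and
  exceeds the one at \<open>W\<close> by exactly \<open>\<integral> tr((W' - W) G) d\<mu>\<close>. The resulting bound is affine in \<open>G\<close>, which
  extends it to the convex hull. Passing between variances and mean-zero functions needs the selected weak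
  gradient to be unchanged by adding constants, i.e. that partial derivatives of test functions
  integrate to \<open>0\<close>.
\<close>

section \<open>Test functions and the integrals of their partial derivatives\<close>

lemma test_function_differentiable: "test_function \<phi> \<Longrightarrow> \<phi> differentiable (at x)"
  unfolding test_function_def by (metis C_k.simps(2))

lemma continuous_on_partial_deriv:
  assumes "test_function \<phi>" shows "continuous_on UNIV (partial_deriv i \<phi>)"
proof -
  have "C_k (Suc 0) \<phi>" using assms unfolding test_function_def by blast
  then show ?thesis by simp
qed

lemma test_function_support:
  fixes \<phi> :: "real^'n::finite \<Rightarrow> real"
  assumes "test_function \<phi>"
  obtains R where "0 < R" "\<And>x. R < norm x \<Longrightarrow> \<phi> x = 0" "\<And>x i. R < norm x \<Longrightarrow> partial_deriv i \<phi> x = 0"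
proof -
  have "bounded (closure {x. \<phi> x \<noteq> 0})"
    using assms compact_imp_bounded by (auto simp: test_function_def)
  then obtain R where R: "0 < R" "\<And>x. x \<in> closure {x. \<phi> x \<noteq> 0} \<Longrightarrow> norm x \<le> R"
    by (metis bounded_pos)
  have 0: "\<phi> x = 0" if "R < norm x" for x
    using R(2)[of x] that closure_subset[of "{x. \<phi> x \<noteq> 0}"] by force
  have "partial_deriv i \<phi> x = 0" if "R < norm x" for x i
  proof -
    \<comment> \<open>Off the ball \<open>\<phi>\<close> agrees with the zero function on a whole
      neighbourhood, so its derivative is that of \<open>0\<close>.\<close>
    have "open {y :: real^'n. R < norm y}"
      by (intro open_Collect_less continuous_intros)
    then have "(\<phi> has_derivative (\<lambda>_. 0)) (at x)"
      using has_derivative_transform_within_open[of "\<lambda>_. 0" "\<lambda>_. 0" x UNIV "{y. R < norm y}" \<phi>] that 0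
      by auto
    then show ?thesis
      by (simp add: partial_deriv_def frechet_derivative_at[symmetric])
  qed
  with R(1) 0 that show thesis by blast
qed

lemma partial_deriv_bounded:
  fixes \<phi> :: "real^'n::finite \<Rightarrow> real"
  assumes "test_function \<phi>"
  obtains M where "\<And>x. \<bar>partial_deriv i \<phi> x\<bar> \<le> M"
proof -
  obtain R where R: "0 < R" "\<And>x. R < norm x \<Longrightarrow> partial_deriv i \<phi> x = 0"
    using test_function_support[OF assms] by metis
  have "compact (partial_deriv i \<phi> ` cball 0 R)"
    by (intro compact_continuous_image continuous_on_subset[OF continuous_on_partial_deriv[OF assms]]) auto
  then obtain M where M: "\<And>x. x \<in> cball 0 R \<Longrightarrow> norm (partial_deriv i \<phi> x) \<le> M"
    by (meson compact_imp_bounded bounded_iff image_eqI)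
  \<comment> \<open>Outside the ball the derivative is \<open>0\<close>, and the bound at the
    centre, \<open>M[of 0]\<close>, shows that \<open>M\<close> is nonnegative.\<close>
  have "\<bar>partial_deriv i \<phi> x\<bar> \<le> M" for x
    using M[of x] M[of 0] R by (cases "norm x \<le> R") (auto simp: not_le)
  with that show thesis by blast
qed

text \<open>Restriction to a line serves twice: at \<open>t = 0\<close> it gives the limit of the
  difference quotients, and at general \<open>t\<close> it feeds the one-dimensional mean value
  theorem that bounds them.\<close>

lemma has_real_derivative_along_axis:
  fixes \<phi> :: "real^'n::finite \<Rightarrow> real"
  assumes "test_function \<phi>"
  shows "((\<lambda>t. \<phi> (x + t *\<^sub>R axis i 1)) has_real_derivative partial_deriv i \<phi> (x + t *\<^sub>R axis i 1)) (at t)"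
proof -
  let ?y = "x + t *\<^sub>R axis i 1"
  have D: "(\<phi> has_derivative frechet_derivative \<phi> (at ?y)) (at ?y)"
    using test_function_differentiable[OF assms] frechet_derivative_works by blast
  have "((\<lambda>t. x + t *\<^sub>R axis i 1) has_derivative (\<lambda>h. h *\<^sub>R axis i 1)) (at t)"
    by (auto intro!: derivative_eq_intros)
  from diff_chain_at[OF this D] show ?thesis
    unfolding has_field_derivative_def o_def partial_deriv_def
    using linear_scale[OF has_derivative_linear[OF D]]
    by (simp add: mult_commute_abs)
qed

text \<open>The partial derivative is bounded and vanishes off a ball, so a multiple of
  \<open>f\<close> cut off to that ball dominates the product.\<close>

lemma integrable_mult_partial_deriv:
  fixes f :: "real^'n::finite \<Rightarrow> real"
  assumes "test_function \<phi>" "locally_integrable f" "f \<in> borel_measurable borel"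
  shows "integrable lborel (\<lambda>x. f x * partial_deriv i \<phi> x)"
proof -
  obtain R where R: "0 < R" "\<And>x. R < norm x \<Longrightarrow> partial_deriv i \<phi> x = 0"
    using test_function_support[OF assms(1)] by metis
  obtain M where M: "\<And>x. \<bar>partial_deriv i \<phi> x\<bar> \<le> M"
    using partial_deriv_bounded[OF assms(1)] by blast
  have [measurable]: "partial_deriv i \<phi> \<in> borel_measurable borel"
    using continuous_on_partial_deriv[OF assms(1)] by (rule borel_measurable_continuous_onI)
  note assms(3)[measurable]
  have "set_integrable lborel (cball 0 R) f"
    using assms(2) by (auto simp: locally_integrable_def)
  then have "integrable lborel (\<lambda>x. M * (indicator (cball 0 R) x *\<^sub>R f x))"
    unfolding set_integrable_def by (intro integrable_mult_right)
  then show ?thesis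
  proof (rule Bochner_Integration.integrable_bound)
    show "AE x in lborel. norm (f x * partial_deriv i \<phi> x) \<le> norm (M * (indicator (cball 0 R) x *\<^sub>R f x))"
    proof (intro AE_I2)
      fix x show "norm (f x * partial_deriv i \<phi> x) \<le> norm (M * (indicator (cball 0 R) x *\<^sub>R f x))"
        using mult_right_mono[OF M, of "\<bar>f x\<bar>" x] R(2)[of x] order_trans[OF abs_ge_zero M[of x]]
        by (cases "norm x \<le> R") (auto simp: abs_mult mult.commute)
    qed
  qed simp
qed

lemma locally_integrable_const: "locally_integrable (\<lambda>_::real^'n::finite. c::real)"
  unfolding locally_integrable_def set_integrable_def
  by (intro allI impI borel_integrable_compact) auto

text \<open>By translation invariance, the difference quotients of \<open>\<phi>\<close> integrate to \<open>0\<close>.\<close>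

lemma integral_partial_deriv_eq_0:
  fixes \<phi> :: "real^'n::finite \<Rightarrow> real"
  assumes \<phi>: "test_function \<phi>"
  shows "(LINT x|lborel. partial_deriv i \<phi> x) = 0"
proof -
  define e :: "real^'n" where "e = axis i 1"
  have [simp]: "norm e = 1" by (simp add: e_def)
  \<comment> \<open>Any positive null sequence bounded by \<open>1\<close> would do; the bound
    \<open>1\<close> keeps all shifted supports inside the ball of radius
    \<open>R + 1\<close>.\<close>
  define h :: "nat \<Rightarrow> real" where "h n = 1 / (real n + 1)" for n
  have h: "0 < h n" "h n \<le> 1" for n by (auto simp: h_def)
  have h0: "h \<longlonglongrightarrow> 0" unfolding h_def by real_asymp
  obtain R where R: "0 < R" "\<And>x. R < norm x \<Longrightarrow> \<phi> x = 0"
    using test_function_support[OF \<phi>] by metis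
  obtain M where M: "\<And>x. \<bar>partial_deriv i \<phi> x\<bar> \<le> M"
    using partial_deriv_bounded[OF \<phi>] by blast
  have cont: "continuous_on UNIV \<phi>"
    using test_function_differentiable[OF \<phi>]
    by (intro differentiable_imp_continuous_on) (auto simp: differentiable_on_def intro: differentiable_at_withinI)
  then have [measurable]: "\<phi> \<in> borel_measurable borel" by (rule borel_measurable_continuous_onI)
  have [measurable]: "partial_deriv i \<phi> \<in> borel_measurable borel"
    using continuous_on_partial_deriv[OF \<phi>] by (rule borel_measurable_continuous_onI)
  have int: "integrable lborel \<phi>"
  proof -
    have "integrable lborel (\<lambda>x. indicator (cball 0 R) x *\<^sub>R \<phi> x)"
      by (rule borel_integrable_compact) (auto intro: continuous_on_subset[OF cont])
    moreover have "(\<lambda>x. indicator (cball 0 R) x *\<^sub>R \<phi> x) = \<phi>"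
      using R(2) by (auto simp: fun_eq_iff indicator_def not_le)
    ultimately show ?thesis by simp
  qed
  have shift: "integrable lborel (\<lambda>x. \<phi> (x + a))" "(LINT x|lborel. \<phi> (x + a)) = (LINT x|lborel. \<phi> x)" for a
    using int integrable_distr_eq[of "(+) a" lborel borel \<phi>] integral_distr[of "(+) a" lborel borel \<phi>]
    by (simp_all add: lborel_distr_plus add.commute)
  define q where "q n x = (\<phi> (x + h n *\<^sub>R e) - \<phi> x) / h n" for n x
  \<comment> \<open>Domination of \<open>q n\<close>: on the larger ball the mean value theorem
    turns the quotient into a value of the partial derivative, at most \<open>M\<close>; off it,
    both points lie outside the support and the quotient is \<open>0\<close>.\<close>
  have "(\<lambda>n. LINT x|lborel. q n x) \<longlonglongrightarrow> (LINT x|lborel. partial_deriv i \<phi> x)"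
  proof (rule integral_dominated_convergence[where w = "\<lambda>x. indicator (cball 0 (R + 1)) x *\<^sub>R M"])
    show "integrable lborel (\<lambda>x. indicator (cball (0::real^'n) (R + 1)) x *\<^sub>R M)"
      by (rule borel_integrable_compact) auto
    show "AE x in lborel. (\<lambda>n. q n x) \<longlonglongrightarrow> partial_deriv i \<phi> x"
    proof (intro AE_I2)
      fix x
      have "((\<lambda>t. (\<phi> (x + t *\<^sub>R e) - \<phi> x) / t) \<longlongrightarrow> partial_deriv i \<phi> x) (at 0)"
        using has_real_derivative_along_axis[OF \<phi>, of x i 0]
        by (simp add: DERIV_def e_def)
      moreover have "filterlim h (at 0) sequentially"
        using h0 h by (auto simp: filterlim_at intro!: always_eventually less_imp_neq[THEN not_sym])
      ultimately show "(\<lambda>n. q n x) \<longlonglongrightarrow> partial_deriv i \<phi> x"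
        unfolding q_def by (rule filterlim_compose)
    qed
    show "AE x in lborel. norm (q n x) \<le> indicator (cball 0 (R + 1)) x *\<^sub>R M" for n
    proof (intro AE_I2)
      fix x
      show "norm (q n x) \<le> indicator (cball 0 (R + 1)) x *\<^sub>R M"
      proof (cases "norm x \<le> R + 1")
        case True
        obtain t where "\<phi> (x + h n *\<^sub>R e) - \<phi> (x + 0 *\<^sub>R e) = (h n - 0) * partial_deriv i \<phi> (x + t *\<^sub>R e)"
          using MVT2[of 0 "h n", OF h(1) has_real_derivative_along_axis[OF \<phi>, of x i]]
          unfolding e_def by metis
        then have "q n x = partial_deriv i \<phi> (x + t *\<^sub>R e)"
          using h(1)[of n] by (simp add: q_def)
        with True M show ?thesis by simp
      next
        case False
        have "norm x \<le> norm (x + h n *\<^sub>R e) + norm (h n *\<^sub>R e)"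
          by (metis add_diff_cancel_right' norm_triangle_ineq4)
        with False h[of n] have "R < norm (x + h n *\<^sub>R e)" by simp
        with False show ?thesis using R by (simp add: q_def)
      qed
    qed
  qed (auto simp: q_def)
  moreover have "(LINT x|lborel. q n x) = 0" for n
    unfolding q_def using int shift[of "h n *\<^sub>R e"] by simp
  ultimately show ?thesis
    by (simp add: LIMSEQ_const_iff)
qed

section \<open>Weak gradients under addition of constants\<close>

text \<open>The constant contributes \<open>c\<close> times the integral of a partial derivative of
  a test function, which is \<open>0\<close>; integrability of both products allows the integral to
  be split.\<close>

lemma has_weak_gradient_add_const:
  assumes "has_weak_gradient f g"
  shows "has_weak_gradient (\<lambda>x. f x + c) g"
proof -
  have f: "f \<in> borel_measurable borel" "locally_integrable f"
    using assms by (auto simp: has_weak_gradient_def)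
  have "locally_integrable (\<lambda>x. f x + c)"
    using f(2) locally_integrable_const[of c]
    unfolding locally_integrable_def set_integrable_def
    by (auto simp: distrib_left intro!: Bochner_Integration.integrable_add)
  moreover have "(LINT x|lborel. (f x + c) * partial_deriv i \<phi> x) = (LINT x|lborel. f x * partial_deriv i \<phi> x)"
    if "test_function \<phi>" for \<phi> i
    using integrable_mult_partial_deriv[OF that f(2,1)]
      integrable_mult_partial_deriv[OF that locally_integrable_const, of c]
      integral_partial_deriv_eq_0[OF that]
    by (simp add: distrib_right)
  ultimately show ?thesis
    using assms by (auto simp: has_weak_gradient_def)
qed

lemma has_weak_gradient_add_const_iff:
  "has_weak_gradient (\<lambda>x. f x + c) g \<longleftrightarrow> has_weak_gradient f g"
  using has_weak_gradient_add_const[of f g c] has_weak_gradient_add_const[of "\<lambda>x. f x + c" g "- c"]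
  by auto

text \<open>Both functions have the same set of weak gradients, so \<open>SOME\<close> selects the
  same one. The equality holds at every point, hence survives integration against a
  \<open>\<mu>\<close> that charges Lebesgue-null sets.\<close>

lemma weak_grad_diff_const: "weak_grad (\<lambda>x. f x - c) = weak_grad f"
  using has_weak_gradient_add_const_iff[of f "- c"] by (simp add: weak_grad_def)


section \<open>Linearity of the energy in the matrix field\<close>

lemma weak_grad_measurable:
  assumes "has_weak_gradient f g"
  shows "weak_grad f \<in> borel_measurable borel"
proof -
  have "has_weak_gradient f (weak_grad f)"
    unfolding weak_grad_def using assms by (rule someI[where P = "has_weak_gradient f"])
  then show ?thesis by (simp add: has_weak_gradient_def)
qed

lemma borel_measurable_quadratic_form:
  fixes A :: "'a \<Rightarrow> real^'n^'n::finite" and v :: "'a \<Rightarrow> real^'n"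
  assumes [measurable]: "A \<in> borel_measurable M" "v \<in> borel_measurable M"
  shows "(\<lambda>x. v x \<bullet> (A x *v v x)) \<in> borel_measurable M"
proof -
  have [measurable]: "(\<lambda>x. v x $ i) \<in> borel_measurable M" for i
    by (rule measurable_compose[OF assms(2)]) (intro borel_measurable_continuous_onI continuous_intros)
  have [measurable]: "(\<lambda>x. A x $ i $ j) \<in> borel_measurable M" for i j
    by (rule measurable_compose[OF assms(1)]) (intro borel_measurable_continuous_onI continuous_intros)
  show ?thesis
    unfolding inner_vec_def matrix_vector_mult_def by simp
qed

lemma psd_fields_nonneg: "W \<in> psd_fields \<Longrightarrow> 0 \<le> v \<bullet> (W x *v v)"
  by (simp add: psd_fields_def psd_matrices_def)

text \<open>The bridge from the trace pairing with \<open>G\<close> to the integrand of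
  \<open>energy\<close>.\<close>

lemma trace_mult_outer:
  fixes A :: "real^'n^'n::finite"
  shows "trace (A ** (c *\<^sub>R (\<chi> i j. v $ i * v $ j))) = c * (v \<bullet> (A *v v))"
  by (simp add: trace_def matrix_matrix_mult_def inner_vec_def matrix_vector_mult_def
      sum_distrib_left algebra_simps)

text \<open>\<open>weak_grad f\<close> does not involve the matrix field, so the integrand is linear
  in it; nonnegativity of both summands lets \<open>ennreal\<close> distribute over the sum.\<close>

lemma energy_add_scaleR:
  fixes \<mu> :: "(real^'n::finite) measure"
  assumes "sets \<mu> = sets borel" "V \<in> psd_fields" "W \<in> psd_fields" "0 \<le> a" "0 \<le> b" "has_weak_gradient f g"
  shows "energy \<mu> (a *\<^sub>R V + b *\<^sub>R W) f = ennreal a * energy \<mu> V f + ennreal b * energy \<mu> W f"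
proof -
  have [measurable]: "(\<lambda>x. weak_grad f x \<bullet> (U x *v weak_grad f x)) \<in> borel_measurable \<mu>" if "U \<in> psd_fields" for U
    using that weak_grad_measurable[OF assms(6)] assms(1)
    by (intro borel_measurable_quadratic_form) (auto simp: psd_fields_def cong: measurable_cong_sets)
  note [measurable] = this[OF assms(2)] this[OF assms(3)]
  have "energy \<mu> (a *\<^sub>R V + b *\<^sub>R W) f =
      (\<integral>\<^sup>+ x. ennreal a * ennreal (weak_grad f x \<bullet> (V x *v weak_grad f x)) +
        ennreal b * ennreal (weak_grad f x \<bullet> (W x *v weak_grad f x)) \<partial>\<mu>)"
    unfolding energy_def using assms(2-5)
    by (intro nn_integral_cong)
      (simp add: plus_fun_def matrix_vector_mult_add_rdistrib inner_add_right psd_fields_nonneg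
        scaleR_matrix_vector_assoc[symmetric] ennreal_plus[symmetric] ennreal_mult[symmetric]
        del: ennreal_plus)
  also have "\<dots> = ennreal a * energy \<mu> V f + ennreal b * energy \<mu> W f"
    by (simp add: nn_integral_add nn_integral_cmult energy_def)
  finally show ?thesis .
qed

section \<open>The reciprocal Poincare constant as a largest lower constant\<close>

lemma ennreal_inverse_antimono:
  fixes a b :: ennreal
  shows "a \<le> b \<Longrightarrow> inverse b \<le> inverse a"
  including ennreal.lifting by transfer (rule ereal_inverse_antimono)

text \<open>The hypothesis makes \<open>1 / c\<close> admissible in the Poincare inequality, and
  inversion reverses the order.\<close>

lemma le_inverse_poincare_const:
  assumes "\<And>f. f \<in> H1 \<mu> W \<Longrightarrow> c * var \<mu> f \<le> energy \<mu> W f"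
  shows "c \<le> 1 / poincare_const \<mu> W"
proof -
  \<comment> \<open>The case \<open>c = 0\<close> is set aside: there \<open>1 / c\<close> is
    infinite, and \<open>\<infinity> * 0 = 0\<close> could break the inequality for functions of
    zero energy.\<close>
  have "var \<mu> f \<le> 1 / c * energy \<mu> W f" if f: "f \<in> H1 \<mu> W" and "c \<noteq> 0" for f
  proof (cases "c = top")
    \<comment> \<open>Now \<open>1 / c\<close> is \<open>0\<close>, so the variance itself must
      vanish: otherwise \<open>c\<close> times it would be infinite, against the finite
      energy.\<close>
    case True
    have "energy \<mu> W f < top"
      using f le_less_trans[of "energy \<mu> W f" "l2_sq \<mu> f + energy \<mu> W f"] by (auto simp: H1_def)
    with assms[OF f] True show ?thesis
      by (auto simp: ennreal_top_mult split: if_splits)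
  next
    case False
    have "var \<mu> f = 1 / c * (c * var \<mu> f)"
      using that False by (simp add: mult_divide_eq_ennreal ennreal_divide_times mult.commute[of c])
    also have "\<dots> \<le> 1 / c * energy \<mu> W f"
      by (intro mult_left_mono assms[OF f]) simp
    finally show ?thesis .
  qed
  then have "poincare_const \<mu> W \<le> 1 / c" if "c \<noteq> 0"
    using that unfolding poincare_const_def by (intro Inf_lower) auto
  then have "c \<noteq> 0 \<Longrightarrow> 1 / (1 / c) \<le> 1 / poincare_const \<mu> W"
    by (auto simp: divide_ennreal_def intro: ennreal_inverse_antimono)
  then show ?thesis by (cases "c = 0") auto
qed

text \<open>A finite infimum in \<open>poincare_const\<close> is itself admissible; multiplying its
  inequality by the reciprocal gives the claim. If it is infinite, the reciprocal is
  \<open>0\<close>.\<close>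

lemma inverse_poincare_const_mult_var_le:
  assumes f: "f \<in> H1 \<mu> W"
  shows "1 / poincare_const \<mu> W * var \<mu> f \<le> energy \<mu> W f"
proof -
  let ?C = "poincare_const \<mu> W" and ?e = "energy \<mu> W f"
  have *: "?e < top"
    using f le_less_trans[of "energy \<mu> W f" "l2_sq \<mu> f + energy \<mu> W f"] by (auto simp: H1_def)
  show ?thesis
  proof (cases "?C = top")
    case False
    have "var \<mu> f \<le> ?C * ?e"
    proof (cases "?e = 0")
      case True
      \<comment> \<open>Division by the energy is impossible here. Finiteness of the infimum yields
        some admissible \<open>C\<close>, and \<open>C * 0 = 0\<close> kills the variance.\<close>
      obtain C where "\<forall>f\<in>H1 \<mu> W. var \<mu> f \<le> C * energy \<mu> W f"
        using False unfolding poincare_const_def by (metis (mono_tags, lifting) Inf_empty empty_Collect_eq)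
      with f True show ?thesis by force
    next
      case e: False
      \<comment> \<open>Every admissible constant is at least this quotient, hence so is the
        infimum.\<close>
      have "var \<mu> f / ?e \<le> ?C"
        unfolding poincare_const_def
        using e f by (auto intro!: Inf_greatest divide_le_posI_ennreal simp: zero_less_iff_neq_zero mult.commute)
      then have "var \<mu> f / ?e * ?e \<le> ?C * ?e" by (intro mult_right_mono) auto
      with e * show ?thesis
        by (simp add: ennreal_divide_times)
    qed
    \<comment> \<open>For \<open>?C = 0\<close> the reciprocal is infinite, but the variance is then
      \<open>0\<close> and the product is \<open>0\<close>.\<close>
    then show ?thesis
    proof (cases "?C = 0")
      case C: False
      have "1 / ?C * var \<mu> f \<le> 1 / ?C * (?C * ?e)"
        by (intro mult_left_mono \<open>var \<mu> f \<le> ?C * ?e\<close>) simp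
      also have "\<dots> = ?e"
        using C False by (simp add: ennreal_divide_times mult.commute[of ?C] mult_divide_eq_ennreal)
      finally show ?thesis .
    qed simp
  qed simp
qed

section \<open>Concavity\<close>

lemma concave_inverse_poincare_const:
  fixes \<mu> :: "(real^'n::finite) measure"
  assumes \<mu>: "sets \<mu> = sets borel"
  shows "concave_on_ennreal psd_fields (\<lambda>W. 1 / poincare_const \<mu> W)"
  unfolding concave_on_ennreal_def
proof (intro conjI ballI allI impI)
  have "convex_cone (psd_fields :: (real^'n \<Rightarrow> real^'n^'n) set)"
    by (rule convex_cone_psd_fields)
  then show "convex (psd_fields :: (real^'n \<Rightarrow> real^'n^'n) set)"
    by (simp add: convex_cone_def)
next
  fix V W :: "real^'n \<Rightarrow> real^'n^'n" and a b :: real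
  assume VW: "V \<in> psd_fields" "W \<in> psd_fields" and ab: "0 \<le> a" "0 \<le> b" "a + b = 1"
  let ?r = "\<lambda>W. 1 / poincare_const \<mu> W"
  \<comment> \<open>Endpoints are separated because a zero weight hides an infinite energy: only
    with both weights positive does membership in \<open>H1\<close> for the combination give
    membership for \<open>V\<close> and for \<open>W\<close>.\<close>
  show "ennreal a * ?r V + ennreal b * ?r W \<le> ?r (a *\<^sub>R V + b *\<^sub>R W)"
  proof (cases "a = 0 \<or> b = 0")
    case True
    have "0 *\<^sub>R V + 1 *\<^sub>R W = W" "1 *\<^sub>R V + 0 *\<^sub>R W = V" by simp_all
    with True ab show ?thesis by auto
  next
    case False
    show ?thesis
    proof (rule le_inverse_poincare_const)
      fix f assume f: "f \<in> H1 \<mu> (a *\<^sub>R V + b *\<^sub>R W)"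
      then obtain g where g: "has_weak_gradient f g" by (auto simp: H1_def)
      note E = energy_add_scaleR[OF \<mu> VW ab(1,2) g]
      have "f \<in> H1 \<mu> V" "f \<in> H1 \<mu> W"
        using f g False ab by (auto simp: H1_def E less_top[symmetric] ennreal_mult_eq_top_iff)
      note this[THEN inverse_poincare_const_mult_var_le]
      then have "ennreal a * (?r V * var \<mu> f) + ennreal b * (?r W * var \<mu> f)
          \<le> ennreal a * energy \<mu> V f + ennreal b * energy \<mu> W f"
        by (intro add_mono mult_left_mono) auto
      then show "(ennreal a * ?r V + ennreal b * ?r W) * var \<mu> f \<le> energy \<mu> (a *\<^sub>R V + b *\<^sub>R W) f"
        by (simp add: E distrib_right mult.assoc)
    qed
  qed
qed

section \<open>Centering and minimizers\<close>

lemma H1_square_integrable: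
  assumes \<mu>: "prob_space \<mu>" "sets \<mu> = sets borel" and f: "f \<in> H1 \<mu> W"
  shows "integrable \<mu> f" "integrable \<mu> (\<lambda>x. (f x)\<^sup>2)"
    "l2_sq \<mu> f = ennreal (LINT x|\<mu>. (f x)\<^sup>2)"
proof -
  interpret prob_space \<mu> by fact
  have [measurable]: "f \<in> borel_measurable \<mu>"
    using f \<mu>(2) by (auto simp: H1_def has_weak_gradient_def cong: measurable_cong_sets)
  have "l2_sq \<mu> f < \<infinity>"
    using f le_less_trans[of "l2_sq \<mu> f" "l2_sq \<mu> f + energy \<mu> W f"] by (auto simp: H1_def)
  then show sq: "integrable \<mu> (\<lambda>x. (f x)\<^sup>2)"
    by (intro integrableI_bounded) (auto simp: l2_sq_def)
  then show "integrable \<mu> f"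
  proof -
    \<comment> \<open>Constants are integrable for a probability measure, so this bound makes the
      mean of \<open>f\<close> a genuine integral.\<close>
    have "\<bar>f x\<bar> \<le> 1 + (f x)\<^sup>2" for x
      using sum_squares_bound[of 1 "\<bar>f x\<bar>"] by simp
    with Bochner_Integration.integrable_add[OF integrable_const sq, of 1] show ?thesis
      by (intro Bochner_Integration.integrable_bound[where g = f]) auto
  qed
  show "l2_sq \<mu> f = ennreal (LINT x|\<mu>. (f x)\<^sup>2)"
    unfolding l2_sq_def using sq by (intro nn_integral_eq_integral) auto
qed

text \<open>Links the variance form on all of \<open>H1\<close>, used for
  \<open>poincare_const\<close>, to the mean-zero competitors in \<open>minimizers\<close>.\<close>

lemma H1_diff_mean:
  assumes \<mu>: "prob_space \<mu>" "sets \<mu> = sets borel" and f: "f \<in> H1 \<mu> W"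
  defines "m \<equiv> LINT x|\<mu>. f x"
  shows "(\<lambda>x. f x - m) \<in> H1 \<mu> W" "(LINT x|\<mu>. f x - m) = 0"
    "l2_sq \<mu> (\<lambda>x. f x - m) = var \<mu> f" "energy \<mu> W (\<lambda>x. f x - m) = energy \<mu> W f"
proof -
  interpret prob_space \<mu> by fact
  note I = H1_square_integrable[OF \<mu> f]
  show E: "energy \<mu> W (\<lambda>x. f x - m) = energy \<mu> W f"
    by (simp add: energy_def weak_grad_diff_const)
  show "(LINT x|\<mu>. f x - m) = 0"
    using I(1) by (simp add: m_def prob_space)
  show "l2_sq \<mu> (\<lambda>x. f x - m) = var \<mu> f"
    by (simp add: var_def m_def)
  have "integrable \<mu> (\<lambda>x. (f x - m)\<^sup>2)"
    using I(1,2) by (simp add: power2_diff)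
  then have "l2_sq \<mu> (\<lambda>x. f x - m) < \<infinity>"
    unfolding l2_sq_def by (subst nn_integral_eq_integral) auto
  moreover have "energy \<mu> W f < top"
    using f le_less_trans[of "energy \<mu> W f" "l2_sq \<mu> f + energy \<mu> W f"] by (auto simp: H1_def)
  moreover obtain g where "has_weak_gradient f g" using f by (auto simp: H1_def)
  then have "has_weak_gradient (\<lambda>x. f x - m) g"
    using has_weak_gradient_add_const[of f g "- m"] by simp
  ultimately show "(\<lambda>x. f x - m) \<in> H1 \<mu> W"
    by (auto simp: H1_def E)
qed

lemma rayleigh_minimizer_le:
  assumes \<mu>: "prob_space \<mu>" "sets \<mu> = sets borel" and u: "u \<in> minimizers \<mu> W"
  shows "rayleigh \<mu> W u \<le> 1 / poincare_const \<mu> W"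
proof (rule le_inverse_poincare_const)
  fix f assume f: "f \<in> H1 \<mu> W"
  note D = H1_diff_mean[OF \<mu> f]
  \<comment> \<open>The centred \<open>f\<close> competes with \<open>u\<close> only if its variance
    is nonzero; otherwise the left side is \<open>0\<close>.\<close>
  show "rayleigh \<mu> W u * var \<mu> f \<le> energy \<mu> W f"
  proof (cases "var \<mu> f = 0")
    case False
    then have "rayleigh \<mu> W u \<le> rayleigh \<mu> W (\<lambda>x. f x - (LINT x|\<mu>. f x))"
      using u D by (auto simp: minimizers_def is_arg_min_def not_less)
    also have "\<dots> = energy \<mu> W f / var \<mu> f"
      by (simp add: rayleigh_def D)
    finally have "rayleigh \<mu> W u * var \<mu> f \<le> energy \<mu> W f / var \<mu> f * var \<mu> f"
      by (intro mult_right_mono) auto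
    also have "var \<mu> f < top"
      using D(1,3) le_less_trans[of "var \<mu> f" "var \<mu> f + energy \<mu> W f"] D(4) by (auto simp: H1_def)
    then have "energy \<mu> W f / var \<mu> f * var \<mu> f = energy \<mu> W f"
      using False by (simp add: ennreal_divide_times)
    finally show ?thesis .
  qed simp
qed

section \<open>The supergradient inequality, first at a single minimizer\<close>

text \<open>The bound lives in \<open>ereal\<close> because the integral may be negative.
  Integrability is proved along with it, since the integral of a non-integrable function would
  default to \<open>0\<close>.\<close>

lemma supergradient_inequality_minimizer:
  fixes \<mu> :: "(real^'n::finite) measure"
  assumes \<mu>: "prob_space \<mu>" "sets \<mu> = sets borel"
    and W: "W \<in> psd_fields" "W' \<in> psd_fields" and dom: "\<And>x. W' x \<preceq>\<^sub>L \<Omega> *\<^sub>R W x"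
    and u: "u \<in> minimizers \<mu> W"
  defines "G \<equiv> normalized_outer \<mu> u"
  shows "integrable \<mu> (\<lambda>x. trace ((W' x - W x) ** G x))"
    and "enn2ereal (1 / poincare_const \<mu> W')
      \<le> enn2ereal (1 / poincare_const \<mu> W) + ereal (LINT x|\<mu>. trace ((W' x - W x) ** G x))"
proof -
  interpret prob_space \<mu> by fact
  have uH: "u \<in> H1 \<mu> W" and mean: "(LINT x|\<mu>. u x) = 0" and nz: "l2_sq \<mu> u \<noteq> 0"
    using u by (auto simp: minimizers_def is_arg_min_def)
  define N where "N = (LINT x|\<mu>. (u x)\<^sup>2)"
  have l2: "l2_sq \<mu> u = ennreal N"
    using H1_square_integrable(3)[OF \<mu> uH] by (simp add: N_def)
  with nz have N: "0 < N" by (metis ennreal_eq_0_iff not_le)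
  define q where "q U x = weak_grad u x \<bullet> (U x *v weak_grad u x)" for U x
  obtain g where g: "has_weak_gradient u g" using uH by (auto simp: H1_def)
  have meas: "q U \<in> borel_measurable \<mu>" if "U \<in> psd_fields" for U
    unfolding q_def using that weak_grad_measurable[OF g] \<mu>(2)
    by (intro borel_measurable_quadratic_form) (auto simp: psd_fields_def cong: measurable_cong_sets)
  have nonneg: "0 \<le> q U x" if "U \<in> psd_fields" for U x
    unfolding q_def using that by (rule psd_fields_nonneg)
  have "energy \<mu> W u < \<infinity>"
    using uH le_less_trans[of "energy \<mu> W u" "l2_sq \<mu> u + energy \<mu> W u"] by (auto simp: H1_def)
  then have I: "integrable \<mu> (q W)"
    using meas[OF W(1)] nonneg[OF W(1)]
    by (intro integrableI_bounded) (auto simp: energy_def q_def)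
  have le: "q W' x \<le> \<Omega> * q W x" for x
    using dom[of x]
    by (simp add: loewner_le_def psd_matrices_def q_def matrix_vector_mult_diff_rdistrib inner_diff_right
        scaleR_matrix_vector_assoc[symmetric])
  \<comment> \<open>Domination: \<open>q W'\<close> lies between \<open>0\<close> and
    \<open>\<Omega> * q W x\<close>, which is at most its own absolute value.\<close>
  have I': "integrable \<mu> (q W')"
    using integrable_mult_right[OF I, of \<Omega>] meas[OF W(2)]
    by (rule Bochner_Integration.integrable_bound)
      (use le nonneg[OF W(2)] in \<open>auto simp: abs_of_nonneg intro!: AE_I2 order_trans[OF _ abs_ge_self]\<close>)
  have E: "energy \<mu> U u = ennreal (LINT x|\<mu>. q U x)" if "U \<in> psd_fields" "integrable \<mu> (q U)" for U
    unfolding energy_def q_def[symmetric] using that nonneg by (intro nn_integral_eq_integral) auto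
  have pos: "0 \<le> (LINT x|\<mu>. q U x)" if "U \<in> psd_fields" for U
    using nonneg[OF that] by simp
  have R: "rayleigh \<mu> U u = ennreal ((LINT x|\<mu>. q U x) / N)" if "U \<in> psd_fields" "integrable \<mu> (q U)" for U
    using that N by (simp add: rayleigh_def E l2 divide_ennreal pos)
  have tr: "trace ((W' x - W x) ** G x) = (q W' x - q W x) / N" for x
    by (simp add: G_def normalized_outer_def trace_mult_outer q_def N_def[symmetric]
        matrix_vector_mult_diff_rdistrib inner_diff_right)
  show "integrable \<mu> (\<lambda>x. trace ((W' x - W x) ** G x))"
    unfolding tr using I I' by simp
  \<comment> \<open>Since \<open>u\<close> has mean zero, its variance is
    \<open>l2_sq \<mu> u\<close>, so it tests the Poincare inequality for \<open>W'\<close>.\<close>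
  have "u \<in> H1 \<mu> W'"
    using g by (auto simp: H1_def l2 E[OF W(2) I'])
  then have "1 / poincare_const \<mu> W' * ennreal N \<le> energy \<mu> W' u"
    using inverse_poincare_const_mult_var_le[of u \<mu> W'] by (simp add: var_def mean l2)
  then have "1 / poincare_const \<mu> W' * ennreal N / ennreal N \<le> rayleigh \<mu> W' u"
    unfolding rayleigh_def l2 by (rule divide_right_mono_ennreal)
  then have "1 / poincare_const \<mu> W' \<le> rayleigh \<mu> W' u"
    using N by (simp add: mult_divide_eq_ennreal)
  then have "enn2ereal (1 / poincare_const \<mu> W') \<le> ereal ((LINT x|\<mu>. q W' x) / N)"
    using N by (simp add: R[OF W(2) I'] less_eq_ennreal.rep_eq enn2ereal_ennreal pos[OF W(2)])
  also have "\<dots> = ereal ((LINT x|\<mu>. q W x) / N) + ereal (LINT x|\<mu>. trace ((W' x - W x) ** G x))"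
    unfolding tr using I I' by (simp add: diff_divide_distrib)
  \<comment> \<open>Minimality of \<open>u\<close>, beyond its being a competitor, enters
    here.\<close>
  also have "ereal ((LINT x|\<mu>. q W x) / N) \<le> enn2ereal (1 / poincare_const \<mu> W)"
    using rayleigh_minimizer_le[OF \<mu> u] N
    by (simp add: R[OF W(1) I] less_eq_ennreal.rep_eq enn2ereal_ennreal pos[OF W(1)])
  finally show "enn2ereal (1 / poincare_const \<mu> W')
      \<le> enn2ereal (1 / poincare_const \<mu> W) + ereal (LINT x|\<mu>. trace ((W' x - W x) ** G x))"
    by (simp add: add_right_mono)
qed

text \<open>The integral is linear in \<open>G\<close> where the trace pairing is integrable, so
  integrability is built into the set.\<close>

lemma convex_affine_ereal_bound:
  fixes a b :: ereal and A :: "'x \<Rightarrow> real^'n^'n::finite"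
  assumes "0 \<le> b"
  shows "convex {G. integrable \<mu> (\<lambda>x. trace (A x ** G x)) \<and>
    a \<le> b + ereal (LINT x|\<mu>. trace (A x ** G x))}" (is "convex ?S")
proof (rule convexI)
  fix G H and s t :: real
  assume GH: "G \<in> ?S" "H \<in> ?S" and st: "0 \<le> s" "0 \<le> t" "s + t = 1"
  let ?I = "\<lambda>G. LINT x|\<mu>. trace (A x ** G x)"
  have tr: "trace (A x ** (s *\<^sub>R G + t *\<^sub>R H) x) = s * trace (A x ** G x) + t * trace (A x ** H x)" for x
    by (simp add: plus_fun_def matrix_add_ldistrib trace_add trace_def matrix_matrix_mult_def
        sum_distrib_left sum.distrib algebra_simps)
  have I: "?I (s *\<^sub>R G + t *\<^sub>R H) = s * ?I G + t * ?I H"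
    unfolding tr using GH by simp
  \<comment> \<open>An infinite \<open>b\<close> makes the right side infinite. For finite
    \<open>b\<close>, \<open>a\<close> is finite, or \<open>-\<infinity>\<close> and trivial;
    \<open>\<infinity>\<close> contradicts \<open>G\<close> being in the set.\<close>
  have "a \<le> b + ereal (s * ?I G + t * ?I H)"
  proof (cases b)
    case (real r)
    show ?thesis
    proof (cases a)
      case (real c)
      then have "s * c + t * c \<le> s * (r + ?I G) + t * (r + ?I H)"
        using GH st \<open>b = ereal r\<close> by (intro add_mono mult_left_mono) auto
      moreover have "s * c + t * c = c" "s * r + t * r = r"
        using st(3) by (simp_all add: distrib_right[symmetric])
      ultimately show ?thesis
        using \<open>b = ereal r\<close> real by (simp add: distrib_left)
    qed (use GH real in auto)
  qed (use assms in auto)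
  then show "s *\<^sub>R G + t *\<^sub>R H \<in> ?S"
    using GH by (simp add: I tr del: plus_fun_apply)
qed

theorem proposition3:
  fixes \<mu> :: "(real^'n::finite) measure"
  assumes "prob_space \<mu>" and "sets \<mu> = sets borel"
  shows "concave_on_ennreal psd_fields (\<lambda>W. 1 / poincare_const \<mu> W) \<and>
    (\<forall>W\<in>psd_fields. \<forall>W'\<in>psd_fields. (\<exists>\<Omega>::real. \<forall>x. W' x \<preceq>\<^sub>L \<Omega> *\<^sub>R W x) \<longrightarrow>
      (\<forall>G\<in>supergradients \<mu> W.
        integrable \<mu> (\<lambda>x. trace ((W' x - W x) ** G x)) \<and>
        enn2ereal (1 / poincare_const \<mu> W')
          \<le> enn2ereal (1 / poincare_const \<mu> W)
            + ereal (LINT x|\<mu>. trace ((W' x - W x) ** G x))))"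
proof (intro conjI[OF concave_inverse_poincare_const[OF assms(2)]] ballI impI)
  fix W W' :: "real^'n \<Rightarrow> real^'n^'n" and G
  assume W: "W \<in> psd_fields" "W' \<in> psd_fields" and G: "G \<in> supergradients \<mu> W"
    and "\<exists>\<Omega>::real. \<forall>x. W' x \<preceq>\<^sub>L \<Omega> *\<^sub>R W x"
  then obtain \<Omega> where \<Omega>: "\<And>x. W' x \<preceq>\<^sub>L \<Omega> *\<^sub>R W x" by blast
  \<comment> \<open>A convex set containing the generators contains their hull; without minimizers
    the hull is empty.\<close>
  have "supergradients \<mu> W \<subseteq> {G. integrable \<mu> (\<lambda>x. trace ((W' x - W x) ** G x)) \<and>
      enn2ereal (1 / poincare_const \<mu> W') \<le> enn2ereal (1 / poincare_const \<mu> W)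
        + ereal (LINT x|\<mu>. trace ((W' x - W x) ** G x))}"
    unfolding supergradients_def
    by (intro hull_minimal convex_affine_ereal_bound)
      (auto intro: supergradient_inequality_minimizer[OF assms W \<Omega>] simp del: times_divide_eq_left)
  with G show "integrable \<mu> (\<lambda>x. trace ((W' x - W x) ** G x)) \<and>
      enn2ereal (1 / poincare_const \<mu> W') \<le> enn2ereal (1 / poincare_const \<mu> W)
        + ereal (LINT x|\<mu>. trace ((W' x - W x) ** G x))"
    by blast
qed

end
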